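(* For $\lambda=\mu$, $j\in\{1,\dots,d\}$ and $r=0,\dots,N$, $$\rho(r,j)=\rho(r)\cdot\pi_j,$$ where $\rho(r,j)=\lim_{t\to+\infty}P(\mathcal N(t)=r,J(t)=j)$, $\rho(r)=\sum_{j=1}^d\rho(r,j)$, and $\vec\pi=(\pi_1,\dots,\pi_d)$ is the invariant law of the stochastic matrix $\mathbf C$.
   Context: Let $N,d$ be positive integers, $D=\{1,\dots,d\}$, $\lambda,\mu,\xi>0$, and let $\mathbf C=(c_{l,j})_{l,j\in D}$ be an irreducible stochastic matrix. The process $\mathbf X_t=(\mathcal N(t),J(t))$, $t\ge 0$, is the continuous-time Markov chain on $\{0,1,\dots,N\}\times D$ (first coordinate: level; second coordinate: phase) started at $(0,l_0)$ for some $l_0\in D$, with the following transition rates: from $(0,l)$ to $(1,j)$ at rate $c_{l,j}\lambda N$ for $l,j\in D$; from $(k,j)$ to $(k+1,j)$ at rate $\lambda(N-k)$ for $1\le k\le N-1$; from $(k,j)$ to $(k-1,j)$ at rate $\mu(N+k)$ for $1\le k\le N$; and, in addition, from $(k,j)$ to $(0,j)$ at rate $\xi$ for $1\le k\le N$ (catastrophe; for $k=1$ the total rate from $(1,j)$ to $(0,j)$ is $\mu(N+1)+\xi$). No other transitions occur. The invariant law of $\mathbf C$ is the probability vector $\vec\pi$ with $\pi_j=\sum_{l\in D}\pi_lc_{l,j}$ for all $j\in D$. *)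

theory Defs
  imports "HOL-Probability.Probability"
begin

definition stochastic_on :: "'a set \<Rightarrow> ('a \<Rightarrow> 'a \<Rightarrow> real) \<Rightarrow> bool" where
  "stochastic_on D c \<longleftrightarrow>
     (\<forall>l\<in>D. \<forall>j\<in>D. 0 \<le> c l j) \<and> (\<forall>l\<in>D. (\<Sum>j\<in>D. c l j) = 1)"

primrec matrix_power_on :: "'a set \<Rightarrow> ('a \<Rightarrow> 'a \<Rightarrow> real) \<Rightarrow> nat \<Rightarrow> 'a \<Rightarrow> 'a \<Rightarrow> real" where
  "matrix_power_on D c 0 l j = (if l = j then 1 else 0)"
| "matrix_power_on D c (Suc n) l j = (\<Sum>m\<in>D. matrix_power_on D c n l m * c m j)"

definition irreducible_on :: "'a set \<Rightarrow> ('a \<Rightarrow> 'a \<Rightarrow> real) \<Rightarrow> bool" where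
  "irreducible_on D c \<longleftrightarrow> (\<forall>l\<in>D. \<forall>j\<in>D. \<exists>n. matrix_power_on D c n l j > 0)"

definition invariant_law :: "'a set \<Rightarrow> ('a \<Rightarrow> 'a \<Rightarrow> real) \<Rightarrow> ('a \<Rightarrow> real) \<Rightarrow> bool" where
  "invariant_law D c p \<longleftrightarrow>
     (\<forall>j\<in>D. 0 \<le> p j) \<and> (\<Sum>j\<in>D. p j) = 1 \<and> (\<forall>j\<in>D. p j = (\<Sum>l\<in>D. p l * c l j))"

text \<open>
  Transition function \<open>p t x y\<close> on a finite state space \<open>S\<close> with transition rates
  \<open>q x y\<close> for \<open>x \<noteq> y\<close>. Diagonal values of \<open>q\<close> are never used: the total exit rate of
  \<open>x\<close> is determined by the off-diagonal rates because \<open>S\<close> is finite and each \<open>p t\<close> is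
  stochastic.
\<close>
definition transition_function ::
    "'s set \<Rightarrow> ('s \<Rightarrow> 's \<Rightarrow> real) \<Rightarrow> (real \<Rightarrow> 's \<Rightarrow> 's \<Rightarrow> real) \<Rightarrow> bool" where
  "transition_function S q p \<longleftrightarrow>
     finite S \<and>
     (\<forall>t\<ge>0. stochastic_on S (p t)) \<and>
     (\<forall>x\<in>S. \<forall>y\<in>S. p 0 x y = (if x = y then 1 else 0)) \<and>
     (\<forall>s\<ge>0. \<forall>t\<ge>0. \<forall>x\<in>S. \<forall>y\<in>S. p (s + t) x y = (\<Sum>z\<in>S. p s x z * p t z y)) \<and>
     (\<forall>x\<in>S. \<forall>y\<in>S. x \<noteq> y \<longrightarrow> ((\<lambda>h. p h x y / h) \<longlongrightarrow> q x y) (at_right 0))"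

text \<open>
  The last conjunct is the Markov property
  \<open>P(X\<^sub>u = y | X\<^sub>s = x, past) = p (u - s) x y\<close> along all finite time sequences, multiplied
  out so that conditioning on null events never arises. Only times \<open>t \<ge> 0\<close> matter, and
  no path regularity is required.
\<close>
definition markov_chain_with_rates ::
    "'w measure \<Rightarrow> 's set \<Rightarrow> ('s \<Rightarrow> 's \<Rightarrow> real) \<Rightarrow> 's \<Rightarrow> (real \<Rightarrow> 'w \<Rightarrow> 's) \<Rightarrow> bool" where
  "markov_chain_with_rates M S q x0 X \<longleftrightarrow>
     prob_space M \<and>
     (\<forall>t\<ge>0. X t \<in> measurable M (count_space S)) \<and>
     (AE \<omega> in M. X 0 \<omega> = x0) \<and>
     (\<exists>p. transition_function S q p \<and>
        (\<forall>(n::nat) (t :: nat \<Rightarrow> real) (x :: nat \<Rightarrow> 's).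
           0 \<le> t 0 \<longrightarrow> (\<forall>i\<le>n. t i < t (Suc i)) \<longrightarrow> (\<forall>i\<le>Suc n. x i \<in> S) \<longrightarrow>
           measure M {\<omega> \<in> space M. \<forall>i\<le>Suc n. X (t i) \<omega> = x i} =
           measure M {\<omega> \<in> space M. \<forall>i\<le>n. X (t i) \<omega> = x i} *
             p (t (Suc n) - t n) (x n) (x (Suc n))))"

text \<open>
  States are pairs (level, phase). The summands are added so that for \<open>k = 1\<close> the downward
  rate and the catastrophe rate accumulate to \<open>\<mu> * (N + 1) + \<xi>\<close>.
\<close>
definition rate ::
    "nat \<Rightarrow> real \<Rightarrow> real \<Rightarrow> real \<Rightarrow> (nat \<Rightarrow> nat \<Rightarrow> real) \<Rightarrow> nat \<times> nat \<Rightarrow> nat \<times> nat \<Rightarrow> real" where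
  "rate N lam \<mu> \<xi> c = (\<lambda>(k, l) (m, j).
     (if k = 0 \<and> m = 1 then c l j * lam * real N else 0) +
     (if 1 \<le> k \<and> k < N \<and> m = k + 1 \<and> j = l then lam * (real N - real k) else 0) +
     (if 1 \<le> k \<and> k \<le> N \<and> m + 1 = k \<and> j = l then \<mu> * (real N + real k) else 0) +
     (if 1 \<le> k \<and> k \<le> N \<and> m = 0 \<and> j = l then \<xi> else 0))"

definition joint_prob ::
    "'w measure \<Rightarrow> (real \<Rightarrow> 'w \<Rightarrow> nat \<times> nat) \<Rightarrow> nat \<Rightarrow> nat \<Rightarrow> real \<Rightarrow> real" where
  "joint_prob M X r j t = measure M {\<omega> \<in> space M. fst (X t \<omega>) = r \<and> snd (X t \<omega>) = j}"

definition rho_joint ::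
    "'w measure \<Rightarrow> (real \<Rightarrow> 'w \<Rightarrow> nat \<times> nat) \<Rightarrow> nat \<Rightarrow> nat \<Rightarrow> real" where
  "rho_joint M X r j = Lim at_top (joint_prob M X r j)"

definition rho_level ::
    "'w measure \<Rightarrow> (real \<Rightarrow> 'w \<Rightarrow> nat \<times> nat) \<Rightarrow> nat \<Rightarrow> nat \<Rightarrow> real" where
  "rho_level M X d r = (\<Sum>j\<in>{1..d}. rho_joint M X r j)"

end

theory Submission
  imports Defs
begin

text \<open>
  Irreducibility of \<open>c\<close> together with the catastrophes gives Doeblin's condition, so the
  transition function contracts signed measures of total mass 0 and converges to its unique
  stationary law \<open>v\<close>, which is characterised by the balance equations. Every rate has the
  form \<open>A k m * c l j + B k m * [l = j]\<close>. Summing the balance equations of \<open>v\<close> over the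
  phases yields balance equations for its level marginal \<open>\<rho>\<close>; these and the invariance of \<open>\<pi>\<close>
  show that \<open>\<rho> k * \<pi> l\<close> is balanced as well, so it equals \<open>v\<close> by uniqueness.
\<close>

section \<open>Contraction of stochastic kernels\<close>

text \<open>Triangle inequality and exchange of sums. The common row sum \<open>\<kappa>\<close> is
  left free because the kernel left over in Doeblin's argument has row sums below 1.\<close>

lemma l1_norm_kernel_le:
  fixes a :: "'s \<Rightarrow> real"
  assumes "\<And>x y. x \<in> S \<Longrightarrow> y \<in> S \<Longrightarrow> 0 \<le> K x y"
    and "\<And>x. x \<in> S \<Longrightarrow> (\<Sum>y\<in>S. K x y) = \<kappa>"
  shows "(\<Sum>y\<in>S. \<bar>\<Sum>x\<in>S. a x * K x y\<bar>) \<le> \<kappa> * (\<Sum>x\<in>S. \<bar>a x\<bar>)"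
proof -
  have "(\<Sum>y\<in>S. \<bar>\<Sum>x\<in>S. a x * K x y\<bar>) \<le> (\<Sum>y\<in>S. \<Sum>x\<in>S. \<bar>a x\<bar> * K x y)"
    by (intro sum_mono order_trans[OF sum_abs]) (auto simp: abs_mult assms(1))
  also have "\<dots> = (\<Sum>x\<in>S. \<bar>a x\<bar> * (\<Sum>y\<in>S. K x y))"
    by (subst sum.swap) (simp add: sum_distrib_left)
  also have "\<dots> = \<kappa> * (\<Sum>x\<in>S. \<bar>a x\<bar>)"
    by (simp add: assms(2) sum_distrib_left mult.commute)
  finally show ?thesis .
qed

text \<open>Every row of \<open>K\<close> has mass at least \<open>e\<close> at \<open>y\<close>.
  Removing this common part does not change the image of a signed measure of total mass 0, and what
  remains is a nonnegative kernel with row sums \<open>1 - e\<close>.\<close>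

lemma doeblin_contraction:
  fixes a :: "'s \<Rightarrow> real"
  assumes S: "finite S" and K: "stochastic_on S K" and y: "y \<in> S"
    and e: "\<And>x. x \<in> S \<Longrightarrow> e \<le> K x y" and a: "(\<Sum>x\<in>S. a x) = 0"
  shows "(\<Sum>z\<in>S. \<bar>\<Sum>x\<in>S. a x * K x z\<bar>) \<le> (1 - e) * (\<Sum>x\<in>S. \<bar>a x\<bar>)"
proof -
  define L where "L x z = K x z - (if z = y then e else 0)" for x z
  have "(\<Sum>x\<in>S. a x * K x z) = (\<Sum>x\<in>S. a x * L x z)" for z
    using a by (simp add: L_def right_diff_distrib sum_subtractf flip: sum_distrib_right)
  moreover have "(\<Sum>z\<in>S. L x z) = 1 - e" if "x \<in> S" for x
    using that K S y by (simp add: L_def sum_subtractf stochastic_on_def)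
  moreover have "0 \<le> L x z" if "x \<in> S" "z \<in> S" for x z
    using that K e by (auto simp: L_def stochastic_on_def)
  ultimately show ?thesis
    using l1_norm_kernel_le[of S L "1 - e" a] by simp
qed

section \<open>Transition functions on finite state spaces\<close>

context
  fixes S :: "'s set" and q :: "'s \<Rightarrow> 's \<Rightarrow> real" and p :: "real \<Rightarrow> 's \<Rightarrow> 's \<Rightarrow> real"
  assumes tf: "transition_function S q p"
begin

lemma transition_finite: "finite S"
  using tf by (simp add: transition_function_def)

lemma transition_stochastic: "0 \<le> t \<Longrightarrow> stochastic_on S (p t)"
  using tf by (simp add: transition_function_def)

lemma transition_nonneg: "0 \<le> t \<Longrightarrow> x \<in> S \<Longrightarrow> y \<in> S \<Longrightarrow> 0 \<le> p t x y"
  using transition_stochastic by (simp add: stochastic_on_def)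

lemma transition_row_sum: "0 \<le> t \<Longrightarrow> x \<in> S \<Longrightarrow> (\<Sum>y\<in>S. p t x y) = 1"
  using transition_stochastic by (simp add: stochastic_on_def)

lemma transition_zero: "x \<in> S \<Longrightarrow> y \<in> S \<Longrightarrow> p 0 x y = (if x = y then 1 else 0)"
  using tf by (simp add: transition_function_def)

lemma chapman_kolmogorov:
  "0 \<le> s \<Longrightarrow> 0 \<le> t \<Longrightarrow> x \<in> S \<Longrightarrow> y \<in> S \<Longrightarrow> p (s + t) x y = (\<Sum>z\<in>S. p s x z * p t z y)"
  using tf by (simp add: transition_function_def)

lemma transition_rate:
  "x \<in> S \<Longrightarrow> y \<in> S \<Longrightarrow> x \<noteq> y \<Longrightarrow> ((\<lambda>h. p h x y / h) \<longlongrightarrow> q x y) (at_right 0)"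
  using tf by (simp add: transition_function_def)

section \<open>Generator, balance equations and stationarity\<close>

lemma row_vector_chapman_kolmogorov:
  assumes "0 \<le> s" "0 \<le> t" "y \<in> S"
  shows "(\<Sum>x\<in>S. v x * p (s + t) x y) = (\<Sum>z\<in>S. (\<Sum>x\<in>S. v x * p s x z) * p t z y)"
proof -
  have "(\<Sum>x\<in>S. v x * p (s + t) x y) = (\<Sum>x\<in>S. \<Sum>z\<in>S. v x * p s x z * p t z y)"
    using assms by (simp add: chapman_kolmogorov sum_distrib_left mult.assoc)
  also have "\<dots> = (\<Sum>z\<in>S. (\<Sum>x\<in>S. v x * p s x z) * p t z y)"
    by (subst sum.swap) (simp add: sum_distrib_right)
  finally show ?thesis .
qed

text \<open>This is the right derivative at 0 of the row vector \<open>v p h\<close>, that is,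
  \<open>v\<close> times the generator. Row sums 1 turn the diagonal entry \<open>p h y y\<close>
  into off-diagonal ones, so minus the exit rate of \<open>y\<close> stands for the diagonal of the
  generator.\<close>

lemma generator_tendsto:
  assumes y: "y \<in> S"
  shows "((\<lambda>h. ((\<Sum>x\<in>S. v x * p h x y) - v y) / h) \<longlongrightarrow>
           (\<Sum>x\<in>S - {y}. v x * q x y) - v y * (\<Sum>z\<in>S - {y}. q y z)) (at_right 0)"
proof -
  have "((\<lambda>h. (\<Sum>x\<in>S - {y}. v x * (p h x y / h)) - v y * (\<Sum>z\<in>S - {y}. p h y z / h)) \<longlongrightarrow>
           (\<Sum>x\<in>S - {y}. v x * q x y) - v y * (\<Sum>z\<in>S - {y}. q y z)) (at_right 0)"
    using y by (intro tendsto_intros transition_rate) auto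
  moreover have "\<forall>\<^sub>F h in at_right 0.
      (\<Sum>x\<in>S - {y}. v x * (p h x y / h)) - v y * (\<Sum>z\<in>S - {y}. p h y z / h)
      = ((\<Sum>x\<in>S. v x * p h x y) - v y) / h"
    using eventually_at_right_less
  proof eventually_elim
    case (elim h)
    have 1: "(\<Sum>z\<in>S - {y}. p h y z) = 1 - p h y y"
      using elim y transition_row_sum[of h y] sum.remove[OF transition_finite y, of "p h y"]
      by simp
    have 2: "(\<Sum>x\<in>S - {y}. v x * p h x y) = (\<Sum>x\<in>S. v x * p h x y) - v y * p h y y"
      using sum.remove[OF transition_finite y, of "\<lambda>x. v x * p h x y"] by simp
    have "(\<Sum>x\<in>S - {y}. v x * (p h x y / h)) - v y * (\<Sum>z\<in>S - {y}. p h y z / h)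
      = ((\<Sum>x\<in>S - {y}. v x * p h x y) - v y * (\<Sum>z\<in>S - {y}. p h y z)) / h"
      by (simp add: sum_divide_distrib[symmetric] diff_divide_distrib)
    then show ?case
      unfolding 1 2 by (simp add: algebra_simps)
  qed
  ultimately show ?thesis
    by (rule Lim_transform_eventually)
qed

lemma stationary_imp_balance:
  assumes y: "y \<in> S" and v: "\<And>t. 0 \<le> t \<Longrightarrow> (\<Sum>x\<in>S. v x * p t x y) = v y"
  shows "(\<Sum>x\<in>S - {y}. v x * q x y) = v y * (\<Sum>z\<in>S - {y}. q y z)"
proof -
  have "\<forall>\<^sub>F h in at_right 0. ((\<Sum>x\<in>S. v x * p h x y) - v y) / h = 0"
    using eventually_at_right_less by eventually_elim (simp add: v)
  then have "((\<lambda>h. ((\<Sum>x\<in>S. v x * p h x y) - v y) / h) \<longlongrightarrow> 0) (at_right 0)"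
    by (rule tendsto_eventually)
  from tendsto_unique[OF _ generator_tendsto[OF y] this] show ?thesis
    by simp
qed

text \<open>
  The \<open>l1\<close> distance between \<open>v\<close> and \<open>v p t\<close> is subadditive in \<open>t\<close> and, by balance, \<open>o(t)\<close> at 0.
\<close>
lemma balance_imp_stationary:
  assumes bal: "\<And>y. y \<in> S \<Longrightarrow> (\<Sum>x\<in>S - {y}. v x * q x y) = v y * (\<Sum>z\<in>S - {y}. q y z)"
    and t: "0 \<le> t" and y: "y \<in> S"
  shows "(\<Sum>x\<in>S. v x * p t x y) = v y"
proof -
  define f where "f s = (\<Sum>y\<in>S. \<bar>(\<Sum>x\<in>S. v x * p s x y) - v y\<bar>)" for s
  have f_add: "f (s + u) \<le> f s + f u" if su: "0 \<le> s" "0 \<le> u" for s u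
  proof -
    \<comment> \<open>In vector form:
      \<open>v p (s + u) - v = (v p s - v) p u + (v p u - v)\<close>. The first term is estimated by
      \<open>f s\<close> because a stochastic kernel does not increase the l1 norm.\<close>
    have "(\<Sum>x\<in>S. v x * p (s + u) x y) - v y =
        (\<Sum>z\<in>S. ((\<Sum>x\<in>S. v x * p s x z) - v z) * p u z y) + ((\<Sum>z\<in>S. v z * p u z y) - v y)"
      if "y \<in> S" for y
      using that su by (simp add: row_vector_chapman_kolmogorov left_diff_distrib sum_subtractf)
    then have "f (s + u) \<le> (\<Sum>y\<in>S. \<bar>\<Sum>z\<in>S. ((\<Sum>x\<in>S. v x * p s x z) - v z) * p u z y\<bar>) + f u"
      unfolding f_def sum.distrib[symmetric] by (intro sum_mono) (simp only: abs_triangle_ineq)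
    also have "(\<Sum>y\<in>S. \<bar>\<Sum>z\<in>S. ((\<Sum>x\<in>S. v x * p s x z) - v z) * p u z y\<bar>) \<le> 1 * f s"
      unfolding f_def using su
      by (intro l1_norm_kernel_le) (auto simp: transition_nonneg transition_row_sum)
    finally show ?thesis by simp
  qed
  have f_mult: "f (real (Suc n) * s) \<le> real (Suc n) * f s" if "0 \<le> s" for n s
  proof (induction n)
    case (Suc n)
    have "real (Suc (Suc n)) * s = real (Suc n) * s + s"
      by (simp add: algebra_simps)
    then have "f (real (Suc (Suc n)) * s) \<le> f (real (Suc n) * s) + f s"
      using f_add[of "real (Suc n) * s" s] that by simp
    also have "\<dots> \<le> real (Suc (Suc n)) * f s"
      using Suc by (simp add: algebra_simps)
    finally show ?case .
  qed simp
  have "((\<lambda>h. \<Sum>y\<in>S. \<bar>((\<Sum>x\<in>S. v x * p h x y) - v y) / h\<bar>) \<longlongrightarrow> (\<Sum>y\<in>S. \<bar>0\<bar>)) (at_right 0)"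
  proof (intro tendsto_intros)
    fix y assume "y \<in> S"
    then show "((\<lambda>h. ((\<Sum>x\<in>S. v x * p h x y) - v y) / h) \<longlongrightarrow> 0) (at_right 0)"
      using generator_tendsto[of y v] bal by simp
  qed
  moreover have "\<forall>\<^sub>F h in at_right 0. (\<Sum>y\<in>S. \<bar>((\<Sum>x\<in>S. v x * p h x y) - v y) / h\<bar>) = f h / h"
    using eventually_at_right_less
    by eventually_elim (simp add: f_def sum_divide_distrib)
  ultimately have lim: "((\<lambda>h. f h / h) \<longlongrightarrow> 0) (at_right 0)"
    using Lim_transform_eventually by force
  \<comment> \<open>Cutting \<open>[0, t]\<close> into \<open>n + 1\<close> equal pieces of length
    \<open>h\<close> gives \<open>f t \<le> t * (f h / h)\<close>, which vanishes as
    \<open>n\<close> grows.\<close>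
  have "f t \<le> 0" if "0 < t"
  proof -
    have "filterlim (\<lambda>n. t / real (Suc n)) (at_right 0) sequentially"
      using LIMSEQ_Suc[OF lim_const_over_n[of t]] that
      by (auto simp: filterlim_at intro!: always_eventually)
    from tendsto_mult[OF tendsto_const filterlim_compose[OF lim this], of t]
    have "(\<lambda>n. t * (f (t / real (Suc n)) / (t / real (Suc n)))) \<longlonglongrightarrow> 0"
      by simp
    moreover have "f t \<le> t * (f (t / real (Suc n)) / (t / real (Suc n)))" for n
      using f_mult[of "t / real (Suc n)" n] that by (simp add: mult.commute)
    ultimately show ?thesis
      by (intro LIMSEQ_le_const) auto
  qed
  moreover have "f 0 = 0"
    by (simp add: f_def transition_zero transition_finite if_distrib cong: if_cong)
  ultimately have "f t \<le> 0"
    using t by (cases "t = 0") auto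
  moreover have "\<bar>(\<Sum>x\<in>S. v x * p t x y) - v y\<bar> \<le> f t"
    unfolding f_def
    by (rule member_le_sum[OF y, where f = "\<lambda>y. \<bar>(\<Sum>x\<in>S. v x * p t x y) - v y\<bar>"])
      (auto simp: transition_finite)
  ultimately show ?thesis
    by simp
qed

section \<open>Positivity of transition probabilities\<close>

lemma transition_ge_path:
  assumes "0 \<le> s" "0 \<le> t" "x \<in> S" "z \<in> S" "y \<in> S"
  shows "p s x z * p t z y \<le> p (s + t) x y"
proof -
  have "p s x z * p t z y \<le> (\<Sum>z\<in>S. p s x z * p t z y)"
    by (rule member_le_sum[where f = "\<lambda>z. p s x z * p t z y"])
      (use assms in \<open>auto simp: transition_finite transition_nonneg\<close>)
  with assms show ?thesis
    by (simp add: chapman_kolmogorov)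
qed

lemma transition_off_diagonal_tendsto_0:
  assumes "x \<in> S" "y \<in> S" "x \<noteq> y"
  shows "((\<lambda>h. p h x y) \<longlongrightarrow> 0) (at_right 0)"
proof -
  have "((\<lambda>h. h * (p h x y / h)) \<longlongrightarrow> 0 * q x y) (at_right 0)"
    using assms by (intro tendsto_intros transition_rate) auto
  moreover have "\<forall>\<^sub>F h in at_right 0. h * (p h x y / h) = p h x y"
    using eventually_at_right_less by eventually_elim simp
  ultimately show ?thesis
    using Lim_transform_eventually by force
qed

text \<open>For short times the probability of leaving \<open>x\<close> is below 1, so
  \<open>p h x x\<close> is positive; any \<open>t\<close> is a multiple of such a short step, and
  returning to \<open>x\<close> after each step has positive probability.\<close>

lemma transition_diagonal_pos:
  assumes x: "x \<in> S" and t: "0 \<le> t"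
  shows "0 < p t x x"
proof (cases "t = 0")
  case False
  have "((\<lambda>h. 1 - (\<Sum>y\<in>S - {x}. p h x y)) \<longlongrightarrow> 1 - (\<Sum>y\<in>S - {x}. 0)) (at_right 0)"
    using x by (intro tendsto_intros transition_off_diagonal_tendsto_0) auto
  then have "\<forall>\<^sub>F h in at_right 0. 0 < 1 - (\<Sum>y\<in>S - {x}. p h x y)"
    by (rule order_tendstoD) simp
  then obtain b where b: "0 < b" "\<And>h. 0 < h \<Longrightarrow> h < b \<Longrightarrow> 0 < 1 - (\<Sum>y\<in>S - {x}. p h x y)"
    unfolding eventually_at_right_field by auto
  have small: "0 < p h x x" if "0 < h" "h < b" for h
    using b(2)[OF that] transition_row_sum[of h x] that x
      sum.remove[OF transition_finite x, of "p h x"] by simp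
  have multiple: "0 < p (real (Suc n) * h) x x" if "0 < h" "h < b" for n h
  proof (induction n)
    case 0
    then show ?case using small that by simp
  next
    case (Suc n)
    have "0 < p (real (Suc n) * h) x x * p h x x"
      using Suc small that by simp
    also have "\<dots> \<le> p (real (Suc n) * h + h) x x"
      using that x by (intro transition_ge_path) auto
    also have "real (Suc n) * h + h = real (Suc (Suc n)) * h"
      by (simp add: algebra_simps)
    finally show ?case .
  qed
  obtain n where "t / b < real n"
    using reals_Archimedean2 by blast
  then have "t < real (Suc n) * b"
    using b(1) by (simp add: field_simps)
  then have "t / real (Suc n) < b"
    by (simp add: field_simps)
  then show ?thesis
    using multiple[of "t / real (Suc n)" n] t False by simp
qed (simp add: transition_zero x)

text \<open>Half of the time is spent on each leg. With positivity demanded at all positive times,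
  reachability becomes a transitive relation whose paths need no bookkeeping of durations.\<close>

lemma transition_pos_trans:
  assumes "x \<in> S" "y \<in> S" "z \<in> S" "\<And>t. 0 < t \<Longrightarrow> 0 < p t x y" "\<And>t. 0 < t \<Longrightarrow> 0 < p t y z"
    and t: "0 < t"
  shows "0 < p t x z"
proof -
  have "0 < p (t / 2) x y * p (t / 2) y z"
    using assms by simp
  also have "\<dots> \<le> p (t / 2 + t / 2) x z"
    using assms by (intro transition_ge_path) auto
  finally show ?thesis by simp
qed

text \<open>A positive rate makes \<open>p h x y\<close> positive for small \<open>h\<close>; for
  the remaining time \<open>t - h\<close> the chain may be found at \<open>y\<close> again.\<close>

lemma transition_pos_of_rate_pos:
  assumes xy: "x \<in> S" "y \<in> S" "x \<noteq> y" and "0 < q x y" and t: "0 < t"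
  shows "0 < p t x y"
proof -
  have "\<forall>\<^sub>F h in at_right 0. 0 < p h x y / h"
    using order_tendstoD(1)[OF transition_rate[OF xy]] assms by blast
  then obtain b where b: "0 < b" "\<And>h. 0 < h \<Longrightarrow> h < b \<Longrightarrow> 0 < p h x y / h"
    unfolding eventually_at_right_field by auto
  obtain h where h: "0 < h" "h < min b t"
    using b(1) t dense[of 0 "min b t"] by auto
  have "0 < p h x y * p (t - h) y y"
    using b(2)[of h] h transition_diagonal_pos[OF xy(2), of "t - h"] by (simp add: zero_less_divide_iff)
  also have "\<dots> \<le> p (h + (t - h)) x y"
    using h xy by (intro transition_ge_path) auto
  finally show ?thesis by simp
qed

end

section \<open>Convergence to the stationary law under Doeblin's condition\<close>

definition stationary_law :: "'s set \<Rightarrow> (real \<Rightarrow> 's \<Rightarrow> 's \<Rightarrow> real) \<Rightarrow> ('s \<Rightarrow> real) \<Rightarrow> bool" where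
  "stationary_law S p v \<longleftrightarrow>
     (\<Sum>x\<in>S. v x) = 1 \<and> (\<forall>t\<ge>0. \<forall>y\<in>S. (\<Sum>x\<in>S. v x * p t x y) = v y)"

text \<open>By finiteness of \<open>S\<close>, the mass that the rows of \<open>p 1\<close> put at
  \<open>y0\<close> is bounded below by some \<open>e > 0\<close>. Each unit of time then contracts
  differences of rows by \<open>1 - e\<close>, so the rows merge and settle at a common limit.
  Uniqueness ranges over all signed invariant vectors of total mass 1.\<close>

lemma doeblin_convergence:
  assumes tf: "transition_function S q p" and y0: "y0 \<in> S"
    and pos: "\<And>x. x \<in> S \<Longrightarrow> 0 < p 1 x y0"
  obtains v where
    "\<And>x y. x \<in> S \<Longrightarrow> y \<in> S \<Longrightarrow> ((\<lambda>t. p t x y) \<longlongrightarrow> v y) at_top"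
    "stationary_law S p v"
    "\<And>w y. stationary_law S p w \<Longrightarrow> y \<in> S \<Longrightarrow> w y = v y"
proof -
  note fin = transition_finite[OF tf]
  define e where "e = Min ((\<lambda>x. p 1 x y0) ` S)"
  \<comment> \<open>One factor \<open>1 - e\<close> for each full unit of time; the fractional rest
    of \<open>t\<close> is only known not to expand the norm.\<close>
  define g where "g t = (1 - e) ^ nat \<lfloor>t\<rfloor>" for t :: real
  have e_pos: "0 < e"
    unfolding e_def using fin y0 pos by (subst Min_gr_iff) auto
  have e_le: "e \<le> p 1 x y0" if "x \<in> S" for x
    unfolding e_def using fin that by (intro Min_le) auto
  have "p 1 y0 y0 \<le> (\<Sum>y\<in>S. p 1 y0 y)"
    using fin y0 by (intro member_le_sum) (auto simp: transition_nonneg[OF tf])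
  then have e_le_1: "e \<le> 1"
    using e_le[OF y0] transition_row_sum[OF tf _ y0, of 1] by simp
  have contract_nat: "(\<Sum>y\<in>S. \<bar>\<Sum>x\<in>S. a x * p (real n + s) x y\<bar>) \<le> (1 - e) ^ n * (\<Sum>x\<in>S. \<bar>a x\<bar>)"
    if "(\<Sum>x\<in>S. a x) = 0" "0 \<le> s" for a n s
    using that
  proof (induction n arbitrary: a)
    case 0
    then show ?case
      using l1_norm_kernel_le[of S "p s" 1 a]
      by (simp add: transition_nonneg[OF tf] transition_row_sum[OF tf])
  next
    case (Suc n)
    \<comment> \<open>The first unit of time is split off: \<open>b = a p 1\<close> again has mass
      0, so the induction hypothesis applies to \<open>b\<close> and the one-step contraction bounds
      its norm.\<close>
    define b where "b z = (\<Sum>x\<in>S. a x * p 1 x z)" for z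
    have "(\<Sum>z\<in>S. b z) = (\<Sum>x\<in>S. a x * (\<Sum>z\<in>S. p 1 x z))"
      unfolding b_def by (subst sum.swap) (simp add: sum_distrib_left)
    then have b: "(\<Sum>z\<in>S. b z) = 0"
      using Suc.prems by (simp add: transition_row_sum[OF tf])
    have "real (Suc n) + s = 1 + (real n + s)"
      by simp
    then have "(\<Sum>y\<in>S. \<bar>\<Sum>x\<in>S. a x * p (real (Suc n) + s) x y\<bar>)
        = (\<Sum>y\<in>S. \<bar>\<Sum>z\<in>S. b z * p (real n + s) z y\<bar>)"
      using Suc.prems by (simp only: b_def)
        (intro sum.cong refl arg_cong[where f = abs] row_vector_chapman_kolmogorov[OF tf], auto)
    also have "\<dots> \<le> (1 - e) ^ n * (\<Sum>z\<in>S. \<bar>b z\<bar>)"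
      using Suc.IH[OF b] Suc.prems by simp
    also have "\<dots> \<le> (1 - e) ^ n * ((1 - e) * (\<Sum>x\<in>S. \<bar>a x\<bar>))"
      unfolding b_def using e_le_1 Suc.prems e_le
      by (intro mult_left_mono doeblin_contraction[OF fin _ y0] transition_stochastic[OF tf]) auto
    finally show ?case
      by (simp add: mult_ac)
  qed
  have contract: "\<bar>\<Sum>x\<in>S. a x * p t x y\<bar> \<le> g t * (\<Sum>x\<in>S. \<bar>a x\<bar>)"
    if "(\<Sum>x\<in>S. a x) = 0" "0 \<le> t" "y \<in> S" for a t y
  proof -
    have "\<bar>\<Sum>x\<in>S. a x * p t x y\<bar> \<le> (\<Sum>y\<in>S. \<bar>\<Sum>x\<in>S. a x * p t x y\<bar>)"
      by (rule member_le_sum[OF that(3), where f = "\<lambda>y. \<bar>\<Sum>x\<in>S. a x * p t x y\<bar>"]) (auto simp: fin)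
    also have "\<dots> \<le> g t * (\<Sum>x\<in>S. \<bar>a x\<bar>)"
      using contract_nat[OF that(1), of "t - real (nat \<lfloor>t\<rfloor>)" "nat \<lfloor>t\<rfloor>"] that(2)
      by (simp add: g_def)
    finally show ?thesis .
  qed
  have g_lim: "(g \<longlongrightarrow> 0) at_top"
    unfolding g_def using e_pos e_le_1
    by (intro filterlim_compose[OF LIMSEQ_power_zero]
        filterlim_compose[OF filterlim_nat_sequentially filterlim_floor_sequentially]) auto
  have row_diff: "\<bar>p t x y - p t x' y\<bar> \<le> g t * 2"
    if "0 \<le> t" "x \<in> S" "x' \<in> S" "y \<in> S" for t x x' y
  proof -
    \<comment> \<open>The difference of two point masses has total mass 0 and norm at most 2; the
      case \<open>x = x'\<close> is included.\<close>
    define a where "a z = (if z = x then 1 else 0) - (if z = x' then 1 else 0 :: real)" for z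
    have "(\<Sum>z\<in>S. \<bar>a z\<bar>) \<le> (\<Sum>z\<in>S. (if z = x then 1 else 0) + (if z = x' then 1 else 0))"
      by (intro sum_mono) (auto simp: a_def)
    also have "\<dots> = 2"
      using that fin by (simp add: sum.distrib)
    finally have norm_a: "(\<Sum>z\<in>S. \<bar>a z\<bar>) \<le> 2" .
    have "(\<Sum>z\<in>S. a z) = 0"
      using that fin by (simp add: a_def sum_subtractf)
    moreover have "(\<Sum>z\<in>S. a z * p t z y) = p t x y - p t x' y"
      using that fin by (simp add: a_def left_diff_distrib sum_subtractf if_distrib[of "\<lambda>u. u * _"] cong: if_cong)
    ultimately have "\<bar>p t x y - p t x' y\<bar> \<le> g t * (\<Sum>z\<in>S. \<bar>a z\<bar>)"
      using contract[of a t y] that by simp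
    also have "\<dots> \<le> g t * 2"
      using norm_a e_le_1 by (intro mult_left_mono) (auto simp: g_def)
    finally show ?thesis .
  qed
  have time_diff: "\<bar>p (s + t) x y - p t x y\<bar> \<le> g t * 2"
    if "0 \<le> s" "0 \<le> t" "x \<in> S" "y \<in> S" for s t x y
  proof -
    \<comment> \<open>The row of \<open>p (s + t)\<close> at \<open>x\<close> is an average of rows
      of \<open>p t\<close>, with weights \<open>p s x z\<close>, and each of them is close to the
      row at \<open>x\<close>.\<close>
    have "p (s + t) x y - p t x y = (\<Sum>z\<in>S. p s x z * (p t z y - p t x y))"
      using that transition_row_sum[OF tf that(1,3)]
      by (simp add: chapman_kolmogorov[OF tf] right_diff_distrib sum_subtractf flip: sum_distrib_right)
    also have "\<bar>\<dots>\<bar> \<le> (\<Sum>z\<in>S. p s x z * (g t * 2))"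
      using that row_diff
      by (intro order_trans[OF sum_abs] sum_mono)
        (auto simp: abs_mult transition_nonneg[OF tf] intro!: mult_left_mono)
    also have "\<dots> = g t * 2"
      using transition_row_sum[OF tf that(1,3)] by (simp flip: sum_distrib_right)
    finally show ?thesis .
  qed
  have "\<exists>L. ((\<lambda>t. p t y0 y) \<longlongrightarrow> L) at_top" if y: "y \<in> S" for y
  proof -
    \<comment> \<open>The limit is found along integer times; since \<open>time_diff\<close> is
      uniform in \<open>s\<close>, letting the integer time tend to infinity gives the distance from
      any real time \<open>t\<close> to it.\<close>
    have "Cauchy (\<lambda>n. p (real n) y0 y)"
      unfolding Cauchy_altdef2
    proof (intro allI impI)
      fix r :: real assume "0 < r"
      moreover have "(\<lambda>n. g (real n) * 2) \<longlonglongrightarrow> 0 * 2"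
        by (intro tendsto_intros filterlim_compose[OF g_lim] filterlim_real_sequentially)
      ultimately obtain m where "g (real m) * 2 < r"
        using order_tendstoD(2)[of "\<lambda>n. g (real n) * 2" "0 * 2" sequentially r]
        by (force dest: eventually_happens'[OF sequentially_bot])
      then have "dist (p (real n) y0 y) (p (real m) y0 y) < r" if "m \<le> n" for n
        using time_diff[of "real n - real m" "real m" y0 y] that y0 y by (simp add: dist_real_def)
      then show "\<exists>m. \<forall>n\<ge>m. dist (p (real n) y0 y) (p (real m) y0 y) < r"
        by blast
    qed
    then obtain L where L: "(\<lambda>n. p (real n) y0 y) \<longlonglongrightarrow> L"
      using Cauchy_convergent convergent_def by blast
    have "\<bar>L - p t y0 y\<bar> \<le> g t * 2" if "0 \<le> t" for t
    proof (rule LIMSEQ_le_const2)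
      show "(\<lambda>n. \<bar>p (real n) y0 y - p t y0 y\<bar>) \<longlonglongrightarrow> \<bar>L - p t y0 y\<bar>"
        by (intro tendsto_intros L)
      have "\<bar>p (real n) y0 y - p t y0 y\<bar> \<le> g t * 2" if "nat \<lceil>t\<rceil> \<le> n" for n
        using time_diff[of "real n - t" t y0 y] that \<open>0 \<le> t\<close> y0 y by simp
      then show "\<exists>m. \<forall>n\<ge>m. \<bar>p (real n) y0 y - p t y0 y\<bar> \<le> g t * 2"
        by blast
    qed
    then have "\<forall>\<^sub>F t in at_top. norm (p t y0 y - L) \<le> g t * 2"
      by (intro eventually_at_top_linorderI[of 0]) (simp add: abs_minus_commute)
    moreover have "((\<lambda>t. g t * 2) \<longlongrightarrow> 0) at_top"
      using tendsto_mult_left_zero[OF g_lim] .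
    ultimately have "((\<lambda>t. p t y0 y - L) \<longlongrightarrow> 0) at_top"
      by (rule Lim_null_comparison)
    then show ?thesis
      using Lim_null by blast
  qed
  then obtain v where v: "\<And>y. y \<in> S \<Longrightarrow> ((\<lambda>t. p t y0 y) \<longlongrightarrow> v y) at_top"
    by metis
  have lim: "((\<lambda>t. p t x y) \<longlongrightarrow> v y) at_top" if xy: "x \<in> S" "y \<in> S" for x y
  proof -
    have "\<forall>\<^sub>F t in at_top. norm (p t x y - p t y0 y) \<le> g t * 2"
      using eventually_ge_at_top[of 0] by eventually_elim (use row_diff xy y0 in auto)
    then have "((\<lambda>t. p t x y - p t y0 y) \<longlongrightarrow> 0) at_top"
      using tendsto_mult_left_zero[OF g_lim, of 2] by (rule Lim_null_comparison)
    from tendsto_add[OF this v[OF xy(2)]] show ?thesis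
      by simp
  qed
  have mass: "(\<Sum>y\<in>S. v y) = 1"
  proof (rule tendsto_unique[OF trivial_limit_at_top_linorder])
    show "((\<lambda>t. \<Sum>y\<in>S. p t y0 y) \<longlongrightarrow> (\<Sum>y\<in>S. v y)) at_top"
      by (intro tendsto_sum v)
    show "((\<lambda>t. \<Sum>y\<in>S. p t y0 y) \<longlongrightarrow> 1) at_top"
      by (intro tendsto_eventually eventually_at_top_linorderI[of 0])
        (simp add: transition_row_sum[OF tf] y0)
  qed
  have stat: "(\<Sum>x\<in>S. v x * p t x y) = v y" if t: "0 \<le> t" and y: "y \<in> S" for t y
  proof (rule tendsto_unique[OF trivial_limit_at_top_linorder])
    show "((\<lambda>s. \<Sum>x\<in>S. p s y0 x * p t x y) \<longlongrightarrow> (\<Sum>x\<in>S. v x * p t x y)) at_top"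
      by (intro tendsto_intros v)
    \<comment> \<open>Invariance comes from letting \<open>s\<close> tend to infinity in the
      Chapman-Kolmogorov equation for \<open>p (s + t) y0 y\<close>.\<close>
    have "((\<lambda>s. p (t + s) y0 y) \<longlongrightarrow> v y) at_top"
      by (intro filterlim_compose[OF v[OF y]] filterlim_tendsto_add_at_top[OF tendsto_const] filterlim_ident)
    then show "((\<lambda>s. \<Sum>x\<in>S. p s y0 x * p t x y) \<longlongrightarrow> v y) at_top"
    proof (rule Lim_transform_eventually)
      show "\<forall>\<^sub>F s in at_top. p (t + s) y0 y = (\<Sum>x\<in>S. p s y0 x * p t x y)"
        by (intro eventually_at_top_linorderI[of 0])
          (use t y y0 in \<open>simp add: add.commute[of t] chapman_kolmogorov[OF tf]\<close>)
    qed
  qed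
  have unique: "w y = v y" if w: "stationary_law S p w" and y: "y \<in> S" for w y
  proof (rule tendsto_unique[OF trivial_limit_at_top_linorder])
    \<comment> \<open>The row limits do not depend on \<open>x\<close>, so total mass 1 makes the
      weighted limit \<open>v y\<close>, while invariance keeps the sum at
      \<open>w y\<close>.\<close>
    have "((\<lambda>t. \<Sum>x\<in>S. w x * p t x y) \<longlongrightarrow> (\<Sum>x\<in>S. w x * v y)) at_top"
      using y by (intro tendsto_intros lim)
    then show "((\<lambda>t. \<Sum>x\<in>S. w x * p t x y) \<longlongrightarrow> v y) at_top"
      using w by (simp add: stationary_law_def flip: sum_distrib_right)
    show "((\<lambda>t. \<Sum>x\<in>S. w x * p t x y) \<longlongrightarrow> w y) at_top"
      using w y by (intro tendsto_eventually eventually_at_top_linorderI[of 0])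
        (simp add: stationary_law_def)
  qed
  show thesis
    using lim mass stat unique by (intro that[of v]) (auto simp: stationary_law_def)
qed

section \<open>Product form\<close>

lemma markov_chain_law:
  assumes mc: "markov_chain_with_rates M S q x0 X" and x0: "x0 \<in> S"
  obtains p where "transition_function S q p"
    "\<And>t y. 0 < t \<Longrightarrow> y \<in> S \<Longrightarrow> measure M {\<omega> \<in> space M. X t \<omega> = y} = p t x0 y"
proof -
  interpret prob_space M
    using mc by (simp add: markov_chain_with_rates_def)
  obtain p where tf: "transition_function S q p"
    and markov: "\<And>(n::nat) t x. 0 \<le> t 0 \<Longrightarrow> (\<forall>i\<le>n. t i < t (Suc i)) \<Longrightarrow> (\<forall>i\<le>Suc n. x i \<in> S) \<Longrightarrow>
        measure M {\<omega> \<in> space M. \<forall>i\<le>Suc n. X (t i) \<omega> = x i} =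
        measure M {\<omega> \<in> space M. \<forall>i\<le>n. X (t i) \<omega> = x i} * p (t (Suc n) - t n) (x n) (x (Suc n))"
    using mc unfolding markov_chain_with_rates_def by blast
  have meas: "{\<omega> \<in> space M. X t \<omega> = y} \<in> sets M" if "0 \<le> t" "y \<in> S" for t y
  proof -
    have "X t \<in> measurable M (count_space S)"
      using mc that by (simp add: markov_chain_with_rates_def)
    from measurable_sets[OF this, of "{y}"] that show ?thesis
      by (simp add: vimage_def Int_def conj_commute)
  qed
  have ae: "AE \<omega> in M. X 0 \<omega> = x0"
    using mc by (simp add: markov_chain_with_rates_def)
  have "measure M {\<omega> \<in> space M. X t \<omega> = y} = p t x0 y" if t: "0 < t" and y: "y \<in> S" for t y
  proof -
    have "measure M {\<omega> \<in> space M. X 0 \<omega> = x0 \<and> X t \<omega> = y} = measure M {\<omega> \<in> space M. X 0 \<omega> = x0} * p t x0 y"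
      \<comment> \<open>The Markov property with the two times 0 and \<open>t\<close>; these must
        differ strictly, hence \<open>0 < t\<close>.\<close>
      using markov[of "\<lambda>i. if i = 0 then 0 else t" 0 "\<lambda>i. if i = 0 then x0 else y"] t y x0
      by (simp add: le_Suc_eq all_conj_distrib imp_conjL conj_commute)
    moreover have "measure M {\<omega> \<in> space M. X 0 \<omega> = x0} = 1"
      using ae meas[of 0 x0] x0 by (simp add: prob_Collect_eq_1)
    moreover have "measure M {\<omega> \<in> space M. X 0 \<omega> = x0 \<and> X t \<omega> = y} = measure M {\<omega> \<in> space M. X t \<omega> = y}"
    proof (rule finite_measure_eq_AE)
      show "AE \<omega> in M. (\<omega> \<in> {\<omega> \<in> space M. X 0 \<omega> = x0 \<and> X t \<omega> = y}) = (\<omega> \<in> {\<omega> \<in> space M. X t \<omega> = y})"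
        using ae by eventually_elim auto
      have "{\<omega> \<in> space M. X 0 \<omega> = x0 \<and> X t \<omega> = y} = {\<omega> \<in> space M. X 0 \<omega> = x0} \<inter> {\<omega> \<in> space M. X t \<omega> = y}"
        by auto
      then show "{\<omega> \<in> space M. X 0 \<omega> = x0 \<and> X t \<omega> = y} \<in> sets M"
        using meas[of 0 x0] meas[of t y] x0 y t by simp
    qed (use meas t y in simp)
    ultimately show ?thesis by simp
  qed
  with tf that show thesis by blast
qed

text \<open>\<open>A\<close> collects the level changes that redraw the phase through
  \<open>c\<close>, \<open>B\<close> those that keep it. Both reproduce \<open>\<pi>\<close>, and
  the exit rate depends on the level only, so balance for the product reduces to balance for the
  levels. The sums include the diagonal, which contributes equally to both sides.\<close>

lemma balance_product:
  fixes A B :: "'a \<Rightarrow> 'a \<Rightarrow> real" and c :: "'b \<Rightarrow> 'b \<Rightarrow> real"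
  assumes fin: "finite J" and c: "stochastic_on J c" and \<pi>: "invariant_law J c \<pi>"
    and q: "\<And>k l m j. q (k, l) (m, j) = A k m * c l j + B k m * (if l = j then 1 else 0)"
    and bal: "\<And>m j. m \<in> I \<Longrightarrow> j \<in> J \<Longrightarrow>
      (\<Sum>x\<in>I \<times> J. v x * q x (m, j)) = v (m, j) * (\<Sum>z\<in>I \<times> J. q (m, j) z)"
    and mj: "m \<in> I" "j \<in> J"
  defines "\<rho> \<equiv> \<lambda>k. \<Sum>l\<in>J. v (k, l)"
  shows "(\<Sum>(k, l)\<in>I \<times> J. \<rho> k * \<pi> l * q (k, l) (m, j)) = \<rho> m * \<pi> j * (\<Sum>z\<in>I \<times> J. q (m, j) z)"
proof -
  define E where "E m = (\<Sum>k\<in>I. A m k + B m k)" for m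
  have exit: "(\<Sum>z\<in>I \<times> J. q (m, j) z) = E m" if "j \<in> J" for m j
  proof -
    have "(\<Sum>z\<in>I \<times> J. q (m, j) z) = (\<Sum>k\<in>I. \<Sum>l\<in>J. q (m, j) (k, l))"
      by (simp add: sum.cartesian_product)
    also have "\<dots> = (\<Sum>k\<in>I. A m k * (\<Sum>l\<in>J. c j l) + B m k * (\<Sum>l\<in>J. if j = l then 1 else 0))"
      by (simp only: q sum.distrib sum_distrib_left)
    finally show ?thesis
      using that fin c by (simp add: E_def stochastic_on_def)
  qed
  \<comment> \<open>Summing the balance equations of \<open>v\<close> over the target phase removes
    \<open>c\<close>, because its rows sum to 1.\<close>
  have "(\<Sum>k\<in>I. \<rho> k * (A k m + B k m)) = \<rho> m * E m"
  proof -
    have "\<rho> m * E m = (\<Sum>j\<in>J. v (m, j) * (\<Sum>z\<in>I \<times> J. q (m, j) z))"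
      by (simp add: \<rho>_def exit sum_distrib_right)
    also have "\<dots> = (\<Sum>j\<in>J. \<Sum>k\<in>I. \<Sum>l\<in>J. v (k, l) * q (k, l) (m, j))"
      by (simp add: bal[OF mj(1), symmetric] sum.cartesian_product case_prod_unfold)
    also have "\<dots> = (\<Sum>k\<in>I. \<Sum>l\<in>J. \<Sum>j\<in>J. v (k, l) * q (k, l) (m, j))"
      by (subst sum.swap, rule sum.cong[OF refl], rule sum.swap)
    also have "\<dots> = (\<Sum>k\<in>I. \<Sum>l\<in>J. v (k, l) * (A k m * (\<Sum>j\<in>J. c l j) + B k m * (\<Sum>j\<in>J. if l = j then 1 else 0)))"
      by (simp only: q sum.distrib sum_distrib_left distrib_left)
    also have "\<dots> = (\<Sum>k\<in>I. \<rho> k * (A k m + B k m))"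
      using fin c by (simp add: stochastic_on_def \<rho>_def sum_distrib_right)
    finally show ?thesis by simp
  qed
  moreover have "(\<Sum>(k, l)\<in>I \<times> J. \<rho> k * \<pi> l * q (k, l) (m, j))
      = (\<Sum>k\<in>I. \<rho> k * (A k m + B k m)) * \<pi> j"
  proof -
    have "(\<Sum>(k, l)\<in>I \<times> J. \<rho> k * \<pi> l * q (k, l) (m, j))
        = (\<Sum>k\<in>I. \<Sum>l\<in>J. \<rho> k * \<pi> l * q (k, l) (m, j))"
      by (simp add: sum.cartesian_product)
    also have "\<dots> = (\<Sum>k\<in>I. \<rho> k * (A k m * (\<Sum>l\<in>J. \<pi> l * c l j) + B k m * (\<Sum>l\<in>J. \<pi> l * (if l = j then 1 else 0))))"
      unfolding q by (simp add: sum.distrib sum_distrib_left distrib_left mult_ac)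
    also have "\<dots> = (\<Sum>k\<in>I. \<rho> k * (A k m + B k m) * \<pi> j)"
    proof -
      have "(\<Sum>l\<in>J. \<pi> l * c l j) = \<pi> j"
        using \<pi> mj by (simp add: invariant_law_def)
      moreover have "(\<Sum>l\<in>J. \<pi> l * (if l = j then 1 else 0)) = \<pi> j"
        using fin mj by (simp add: if_distrib cong: if_cong)
      ultimately show ?thesis
        by (simp add: algebra_simps)
    qed
    finally show ?thesis by (simp add: sum_distrib_right)
  qed
  ultimately show ?thesis
    by (simp add: exit mj mult_ac)
qed

text \<open>From any state a catastrophe leads to level 0 in the same phase. A phase step from
  \<open>m\<close> to \<open>j\<close> with \<open>c m j > 0\<close> is then realised by moving up
  to \<open>(1, j)\<close> and back to \<open>(0, j)\<close>; irreducibility connects all phases in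
  this way.\<close>

lemma transition_pos_to_level_0:
  assumes tf: "transition_function ({0..N} \<times> {1..d}) (rate N lam \<mu> \<xi> c) p"
    and N: "1 \<le> N" and rates: "0 < lam" "0 < \<mu>" "0 < \<xi>"
    and c: "stochastic_on {1..d} c" "irreducible_on {1..d} c"
    and x: "x \<in> {0..N} \<times> {1..d}" and j: "j \<in> {1..d}" and t: "0 < t"
  shows "0 < p t x (0, j)"
proof -
  let ?S = "{0..N} \<times> {1..d}"
  have catastrophe: "0 < p t (k, l) (0, l)" if "k \<in> {0..N}" "l \<in> {1..d}" "0 < t" for k l t
  proof (cases "k = 0")
    case True
    then show ?thesis
      using that transition_diagonal_pos[OF tf, of "(0, l)" t] by simp
  next
    case False
    have "0 < rate N lam \<mu> \<xi> c (k, l) (0, l)"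
      using False that rates by (auto simp: rate_def add_nonneg_pos)
    then show ?thesis
      using False that by (intro transition_pos_of_rate_pos[OF tf]) auto
  qed
  have phase: "0 < p t (0, l) (0, j)"
    if "matrix_power_on {1..d} c n l j > 0" "l \<in> {1..d}" "j \<in> {1..d}" "0 < t" for n l j t
    using that
  proof (induction n arbitrary: j t)
    case 0
    then show ?case
      by (auto intro: catastrophe split: if_splits)
  next
    case (Suc n)
    have nonneg: "0 \<le> matrix_power_on {1..d} c n l m" if "m \<in> {1..d}" for n m
      using that c(1) by (induction n arbitrary: m) (auto intro!: sum_nonneg simp: stochastic_on_def)
    \<comment> \<open>A positive entry of the matrix power has a positive summand, whose index
      \<open>m\<close> is the last phase before \<open>j\<close>.\<close>
    obtain m where m: "m \<in> {1..d}" "0 < matrix_power_on {1..d} c n l m * c m j"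
      using Suc.prems(1) sum_nonpos[of "{1..d}" "\<lambda>m. matrix_power_on {1..d} c n l m * c m j"]
      by (force simp: not_less)
    then have pos: "0 < matrix_power_on {1..d} c n l m" "0 < c m j"
      using nonneg[of m n] by (auto simp: zero_less_mult_iff)
    have "0 < rate N lam \<mu> \<xi> c (0, m) (1, j)"
      using pos rates N by (simp add: rate_def)
    then have up: "0 < p t (0, m) (1, j)" if "0 < t" for t
      using that m Suc.prems N by (intro transition_pos_of_rate_pos[OF tf]) auto
    have to_m: "0 < p t (0, l) (0, m)" if "0 < t" for t
      using Suc.IH[OF pos(1)] m Suc.prems that by blast
    have down: "0 < p t (1, j) (0, j)" if "0 < t" for t
      using catastrophe[of 1 j] N Suc.prems that by simp
    have around: "0 < p t (0, m) (0, j)" if "0 < t" for t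
      using transition_pos_trans[OF tf, of "(0, m)" "(1, j)" "(0, j)"] up down that m Suc.prems N by simp
    show ?case
      using transition_pos_trans[OF tf, of "(0, l)" "(0, m)" "(0, j)"] to_m around m Suc.prems by simp
  qed
  obtain k l where kl: "x = (k, l)" "k \<in> {0..N}" "l \<in> {1..d}"
    using x by auto
  obtain n where "matrix_power_on {1..d} c n l j > 0"
    using c(2) kl j unfolding irreducible_on_def by blast
  then show ?thesis
    using transition_pos_trans[OF tf, of "(k, l)" "(0, l)" "(0, j)"] catastrophe phase kl j t by simp
qed

theorem theorem4p8:
  fixes N d l0 j r :: nat
    and lam \<mu> \<xi> :: real
    and c :: "nat \<Rightarrow> nat \<Rightarrow> real"
    and \<pi> :: "nat \<Rightarrow> real"
    and M :: "'w measure"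
    and X :: "real \<Rightarrow> 'w \<Rightarrow> nat \<times> nat"
  assumes "N \<ge> 1" and "d \<ge> 1"
    and "lam > 0" and "\<mu> > 0" and "\<xi> > 0"
    and "stochastic_on {1..d} c"
    and "irreducible_on {1..d} c"
    and "invariant_law {1..d} c \<pi>"
    and "l0 \<in> {1..d}"
    and "markov_chain_with_rates M ({0..N} \<times> {1..d}) (rate N lam \<mu> \<xi> c) (0, l0) X"
    and "lam = \<mu>"
    and "j \<in> {1..d}" and "r \<in> {0..N}"
  shows "(joint_prob M X r j \<longlongrightarrow> rho_joint M X r j) at_top \<and>
         rho_joint M X r j = rho_level M X d r * \<pi> j"
proof -
  let ?S = "{0..N} \<times> {1..d}" and ?q = "rate N lam \<mu> \<xi> c"
  have start: "(0, l0) \<in> ?S"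
    using assms by simp
  obtain p where tf: "transition_function ?S ?q p"
    and law: "\<And>t y. 0 < t \<Longrightarrow> y \<in> ?S \<Longrightarrow> measure M {\<omega> \<in> space M. X t \<omega> = y} = p t (0, l0) y"
    using markov_chain_law[OF assms(10) start] by blast
  \<comment> \<open>Doeblin's condition, with the initial state as the common target.\<close>
  have "0 < p 1 x (0, l0)" if "x \<in> ?S" for x
    using transition_pos_to_level_0[OF tf assms(1,3-7) that assms(9)] by simp
  then obtain v where lim: "\<And>x y. x \<in> ?S \<Longrightarrow> y \<in> ?S \<Longrightarrow> ((\<lambda>t. p t x y) \<longlongrightarrow> v y) at_top"
    and v: "stationary_law ?S p v"
    and unique: "\<And>w y. stationary_law ?S p w \<Longrightarrow> y \<in> ?S \<Longrightarrow> w y = v y"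
    using doeblin_convergence[OF tf start] by blast
  have joint: "(joint_prob M X k l \<longlongrightarrow> v (k, l)) at_top" if "(k, l) \<in> ?S" for k l
  proof (rule Lim_transform_eventually[OF lim[OF start that]])
    show "\<forall>\<^sub>F t in at_top. p t (0, l0) (k, l) = joint_prob M X k l t"
      using eventually_gt_at_top[of 0]
      by eventually_elim (simp add: joint_prob_def law[OF _ that, symmetric] prod_eq_iff)
  qed
  \<comment> \<open>Convergence has been shown first, so \<open>Lim\<close> denotes a genuine limit
    here.\<close>
  then have rho: "rho_joint M X k l = v (k, l)" if "(k, l) \<in> ?S" for k l
    unfolding rho_joint_def using that by (intro tendsto_Lim) auto
  define \<rho> where "\<rho> k = (\<Sum>l\<in>{1..d}. v (k, l))" for k
  have level: "rho_level M X d r = \<rho> r"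
    using assms by (simp add: rho_level_def \<rho>_def rho)
  \<comment> \<open>The product candidate: once its invariance and total mass 1 are known,
    uniqueness identifies it with \<open>v\<close>.\<close>
  define w where "w x = \<rho> (fst x) * \<pi> (snd x)" for x
  define A where "A k m = (if k = 0 \<and> m = 1 then lam * real N else 0)" for k m :: nat
  define B where "B k m =
     (if 1 \<le> k \<and> k < N \<and> m = k + 1 then lam * (real N - real k) else 0) +
     (if 1 \<le> k \<and> k \<le> N \<and> m + 1 = k then \<mu> * (real N + real k) else 0) +
     (if 1 \<le> k \<and> k \<le> N \<and> m = 0 then \<xi> else 0)" for k m :: nat
  have q: "?q (k, l) (m, j) = A k m * c l j + B k m * (if l = j then 1 else 0)" for k l m j
    by (simp add: rate_def A_def B_def)
  \<comment> \<open>A zero diagonal lets the balance equations over \<open>?S - {y}\<close> be read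
    as sums over the full product set, which can be split into levels and phases.\<close>
  have diag: "?q y y = 0" for y
    by (cases y) (simp add: rate_def)
  have bal_v: "(\<Sum>x\<in>?S. v x * ?q x y) = v y * (\<Sum>z\<in>?S. ?q y z)" if "y \<in> ?S" for y
  proof -
    have "(\<Sum>x\<in>?S. v x * p t x y) = v y" if "0 \<le> t" for t
      using v \<open>y \<in> ?S\<close> that by (simp only: stationary_law_def)
    from stationary_imp_balance[OF tf that, OF this] that show ?thesis
      by (simp add: sum_diff1 diag)
  qed
  have "(\<Sum>x\<in>?S. w x * ?q x y) = w y * (\<Sum>z\<in>?S. ?q y z)" if "y \<in> ?S" for y
    using balance_product[OF _ assms(6,8) q bal_v, of "fst y" "snd y"] that
    by (auto simp: w_def \<rho>_def case_prod_unfold)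
  then have "(\<Sum>x\<in>?S. w x * p t x y) = w y" if "0 \<le> t" "y \<in> ?S" for t y
    using that by (intro balance_imp_stationary[OF tf]) (simp_all add: sum_diff1 diag)
  moreover have "(\<Sum>x\<in>?S. w x) = 1"
  proof -
    have "(\<Sum>x\<in>?S. w x) = (\<Sum>k\<in>{0..N}. \<rho> k) * (\<Sum>l\<in>{1..d}. \<pi> l)"
      by (simp add: w_def sum_product sum.cartesian_product case_prod_unfold)
    also have "(\<Sum>k\<in>{0..N}. \<rho> k) = 1"
      using v by (simp add: stationary_law_def \<rho>_def sum.cartesian_product)
    also have "(\<Sum>l\<in>{1..d}. \<pi> l) = 1"
      using assms(8) by (simp only: invariant_law_def)
    finally show ?thesis by simp
  qed
  ultimately have "w (r, j) = v (r, j)"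
    using assms by (intro unique) (auto simp: stationary_law_def)
  then show ?thesis
    using joint[of r j] assms by (simp add: rho level w_def)
qed

end
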